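(* Let $n\ge1$ and $B=(v_1,\dots,v_n)\in\mathrm{GL}_n(\mathbb{R})$. Define linear maps $L^\Phi_B: M_n(\mathbb{R})^2\to\mathcal{S}^2(\mathbb{R}^n)^n$ and $L^\Psi_B:\mathcal{S}^2(\mathbb{R}^n)^n\to\mathcal{S}^3(\mathbb{R}^n)^{n(n-1)/2}$ by $$L^\Phi_B(A',B')=\big(A'\circ Q_{v_i}-Q_{v_i}\circ(A',I)-Q_{v_i}\circ(I,A')+Q_{\omega_i}\big)_{1\le i\le n},$$ where $B'=(\omega_1,\dots,\omega_n)$ (columns), and $$L^\Psi_B(q_1,\dots,q_n)=\big([q_i,Q_{v_j}]-[q_j,Q_{v_i}]\big)_{1\le i<j\le n}.$$ Then $\ker L^\Psi_B=\operatorname{Im}L^\Phi_B$.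
   Context: $\mathcal{S}^r(\mathbb{R}^n)$ denotes the space of symmetric $r$-linear maps $(\mathbb{R}^n)^r\to\mathbb{R}^n$. $\langle\cdot,\cdot\rangle$ is the Euclidean inner product. For $v\in\mathbb{R}^n$, $Q_v\in\mathcal{S}^2(\mathbb{R}^n)$ is $Q_v(\xi,\eta)=\langle\xi,\eta\rangle v-\langle\xi,v\rangle\eta-\langle\eta,v\rangle\xi$. For $Q\in\mathcal{S}^2(\mathbb{R}^n)$ and $A,C\in M_n(\mathbb{R})$, $Q\circ(A,C)(\xi,\eta)=Q(A\xi,C\eta)$ and $A\circ Q(\xi,\eta)=A(Q(\xi,\eta))$. For $Q,Q'\in\mathcal{S}^2(\mathbb{R}^n)$, $[Q,Q']\in\mathcal{S}^3(\mathbb{R}^n)$ is $[Q,Q'](\xi,\eta,\theta)=\{Q(\xi,Q'(\eta,\theta))+Q(\eta,Q'(\theta,\xi))+Q(\theta,Q'(\xi,\eta))\}-\{Q'(\xi,Q(\eta,\theta))+Q'(\eta,Q(\theta,\xi))+Q'(\theta,Q(\xi,\eta))\}$. *)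

theory Defs
  imports "HOL-Analysis.Analysis"
begin

type_synonym 'n vecmap2 = "real^'n \<Rightarrow> real^'n \<Rightarrow> real^'n"
type_synonym 'n vecmap3 = "real^'n \<Rightarrow> real^'n \<Rightarrow> real^'n \<Rightarrow> real^'n"

text \<open>S^2(R^n): symmetric bilinear maps R^n x R^n -> R^n.\<close>
definition S2 :: "'n::finite vecmap2 set" where
  "S2 = {Q. bilinear Q \<and> (\<forall>x y. Q x y = Q y x)}"

text \<open>Q_v(xi,eta) = <xi,eta> v - <xi,v> eta - <eta,v> xi.\<close>
definition Qv :: "real^'n::finite \<Rightarrow> 'n vecmap2" where
  "Qv v = (\<lambda>\<xi> \<eta>. (\<xi> \<bullet> \<eta>) *\<^sub>R v - (\<xi> \<bullet> v) *\<^sub>R \<eta> - (\<eta> \<bullet> v) *\<^sub>R \<xi>)"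

text \<open>The bracket [Q,Q'] in S^3.\<close>
definition brk :: "'n::finite vecmap2 \<Rightarrow> 'n vecmap2 \<Rightarrow> 'n vecmap3" where
  "brk Q Q' = (\<lambda>\<xi> \<eta> \<theta>.
      (Q \<xi> (Q' \<eta> \<theta>) + Q \<eta> (Q' \<theta> \<xi>) + Q \<theta> (Q' \<xi> \<eta>))
    - (Q' \<xi> (Q \<eta> \<theta>) + Q' \<eta> (Q \<theta> \<xi>) + Q' \<theta> (Q \<xi> \<eta>)))"

text \<open>L^Phi_B(A',B'): the i-th component is
  A' o Q_{v_i} - Q_{v_i} o (A',I) - Q_{v_i} o (I,A') + Q_{omega_i},
  with v_i = i-th column of B and omega_i = i-th column of B'.\<close>
definition LPhi :: "real^'n^'n \<Rightarrow> real^'n^'n \<Rightarrow> real^'n^'n \<Rightarrow> ('n::finite \<Rightarrow> 'n vecmap2)" where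
  "LPhi B A' B' = (\<lambda>i \<xi> \<eta>.
      A' *v (Qv (column i B) \<xi> \<eta>)
    - Qv (column i B) (A' *v \<xi>) \<eta>
    - Qv (column i B) \<xi> (A' *v \<eta>)
    + Qv (column i B') \<xi> \<eta>)"

text \<open>L^Psi_B(q): component (i,j), used for i < j: [q_i,Q_{v_j}] - [q_j,Q_{v_i}].\<close>
definition LPsi :: "real^'n^'n \<Rightarrow> ('n::finite \<Rightarrow> 'n vecmap2) \<Rightarrow> 'n \<Rightarrow> 'n \<Rightarrow> 'n vecmap3" where
  "LPsi B q i j = (\<lambda>\<xi> \<eta> \<theta>. brk (q i) (Qv (column j B)) \<xi> \<eta> \<theta> - brk (q j) (Qv (column i B)) \<xi> \<eta> \<theta>)"

text \<open>Kernel of L^Psi_B as a subset of S^2(R^n)^n (components indexed by pairs i<j).\<close>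
definition kerLPsi :: "(real^('n::{finite,linorder}))^('n::{finite,linorder}) \<Rightarrow> (('n::{finite,linorder}) \<Rightarrow> ('n::{finite,linorder}) vecmap2) set" where
  "kerLPsi B = {q. (\<forall>i. q i \<in> S2) \<and> (\<forall>i j. i < j \<longrightarrow> LPsi B q i j = (\<lambda>\<xi> \<eta> \<theta>. 0))}"

text \<open>Image of L^Phi_B over M_n(R)^2.\<close>
definition imLPhi :: "real^'n^'n \<Rightarrow> ('n::finite \<Rightarrow> 'n vecmap2) set" where
  "imLPhi B = {LPhi B A' B' | A' B'. True}"

end

theory Submission imports Defs begin

text \<open>
  Write A\<cdot>Q = A \<circ> Q - Q \<circ> (A,I) - Q \<circ> (I,A). The inclusion of the image in the kernel
  is a direct computation: [Q_v, Q_w] = 0, and [A\<cdot>Q_v, Q_w] is symmetric in v and w.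
  Conversely, since the columns v_i form a basis, q extends to a linear family v \<mapsto> Y v of
  symmetric bilinear maps with Y v_i = q_i and [Y v, Q_w] = [Y w, Q_v] for all v, w.
  Subtracting a suitable family v \<mapsto> A\<cdot>Q_v + Q_{Cv} makes the partial traces of Y vanish and
  the symmetric part of its full contraction a multiple of the identity. Contracting the
  identity [Y v, Q_w] = [Y w, Q_v] in two ways then shows that \<langle>Y l a m, k\<rangle> is totally
  symmetric in l, a, m, k, and a third contraction shows that it equals -3n times itself.
\<close>

text \<open>Qv and brk restated on an arbitrary Euclidean space: on real^'n the componentwise
  ring multiplication would interfere with normalisation by the simplifier.\<close>

definition Q_euclid :: "'a::euclidean_space \<Rightarrow> 'a \<Rightarrow> 'a \<Rightarrow> 'a" where
  "Q_euclid v = (\<lambda>\<xi> \<eta>. (\<xi> \<bullet> \<eta>) *\<^sub>R v - (\<xi> \<bullet> v) *\<^sub>R \<eta> - (\<eta> \<bullet> v) *\<^sub>R \<xi>)"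

definition bracket :: "('a::euclidean_space \<Rightarrow> 'a \<Rightarrow> 'a) \<Rightarrow> ('a \<Rightarrow> 'a \<Rightarrow> 'a) \<Rightarrow> 'a \<Rightarrow> 'a \<Rightarrow> 'a \<Rightarrow> 'a" where
  "bracket Q Q' = (\<lambda>\<xi> \<eta> \<theta>.
      (Q \<xi> (Q' \<eta> \<theta>) + Q \<eta> (Q' \<theta> \<xi>) + Q \<theta> (Q' \<xi> \<eta>))
    - (Q' \<xi> (Q \<eta> \<theta>) + Q' \<eta> (Q \<theta> \<xi>) + Q' \<theta> (Q \<xi> \<eta>)))"

definition lie_act :: "('a::euclidean_space \<Rightarrow> 'a) \<Rightarrow> ('a \<Rightarrow> 'a \<Rightarrow> 'a) \<Rightarrow> 'a \<Rightarrow> 'a \<Rightarrow> 'a" where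
  "lie_act f Q = (\<lambda>\<xi> \<eta>. f (Q \<xi> \<eta>) - Q (f \<xi>) \<eta> - Q \<xi> (f \<eta>))"

definition phi_map :: "('a::euclidean_space \<Rightarrow> 'a) \<Rightarrow> ('a \<Rightarrow> 'a) \<Rightarrow> 'a \<Rightarrow> 'a \<Rightarrow> 'a \<Rightarrow> 'a" where
  "phi_map A C v = (\<lambda>\<xi> \<eta>. lie_act A (Q_euclid v) \<xi> \<eta> + Q_euclid (C v) \<xi> \<eta>)"

lemma vector_eq_by_inner: "(\<And>k. (x::'a::real_inner) \<bullet> k = y \<bullet> k) \<Longrightarrow> x = y"
  using vector_eq_rdot by blast

lemma bracket_Q_Q: "bracket (Q_euclid v) (Q_euclid w) \<xi> \<eta> \<theta> = 0"
  by (rule vector_eq_by_inner) (simp add: bracket_def Q_euclid_def inner_simps algebra_simps inner_commute)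

lemma bracket_lie_act_Q_swap:
  assumes "linear f"
  shows "bracket (lie_act f (Q_euclid v)) (Q_euclid w) \<xi> \<eta> \<theta> = bracket (lie_act f (Q_euclid w)) (Q_euclid v) \<xi> \<eta> \<theta>"
  by (rule vector_eq_by_inner)
    (simp add: bracket_def Q_euclid_def lie_act_def linear_add[OF assms] linear_diff[OF assms]
      linear_scale[OF assms] inner_simps algebra_simps inner_commute)

lemma bracket_add_left:
  "bracket (\<lambda>x y. F x y + G x y) (Q_euclid w) \<xi> \<eta> \<theta> = bracket F (Q_euclid w) \<xi> \<eta> \<theta> + bracket G (Q_euclid w) \<xi> \<eta> \<theta>"
  by (simp add: bracket_def Q_euclid_def inner_simps algebra_simps)

lemma bracket_diff_left:
  "bracket (\<lambda>x y. F x y - G x y) (Q_euclid w) \<xi> \<eta> \<theta> = bracket F (Q_euclid w) \<xi> \<eta> \<theta> - bracket G (Q_euclid w) \<xi> \<eta> \<theta>"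
  by (simp add: bracket_def Q_euclid_def inner_simps algebra_simps)

lemma bracket_phi_map_swap:
  assumes "linear A"
  shows "bracket (phi_map A C v) (Q_euclid w) \<xi> \<eta> \<theta> = bracket (phi_map A C w) (Q_euclid v) \<xi> \<eta> \<theta>"
  by (simp add: phi_map_def bracket_add_left bracket_Q_Q bracket_lie_act_Q_swap[OF assms])

lemma bilinear_bracket_Q:
  assumes "\<And>x y. linear (\<lambda>v. Y v x y)" and "\<And>v. bilinear (Y v)"
  shows "bilinear (\<lambda>v w. bracket (Y v) (Q_euclid w) \<xi> \<eta> \<theta>)"
proof -
  note L = linear_add[OF assms(1)] linear_scale[OF assms(1)]
  have "linear (\<lambda>w. bracket (Y v) (Q_euclid w) \<xi> \<eta> \<theta>)" for v
    using assms(2)[of v]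
    by (intro linearI) (simp_all add: bracket_def Q_euclid_def bilinear_radd bilinear_rmul
        bilinear_rsub inner_simps algebra_simps)
  moreover have "linear (\<lambda>v. bracket (Y v) (Q_euclid w) \<xi> \<eta> \<theta>)" for w
    by (intro linearI) (simp_all add: bracket_def Q_euclid_def L inner_simps algebra_simps)
  ultimately show ?thesis by (simp add: bilinear_def)
qed

definition map_trace :: "('a::euclidean_space \<Rightarrow> 'a) \<Rightarrow> real" where
  "map_trace g = (\<Sum>b\<in>Basis. g b \<bullet> b)"

definition contraction :: "('a::euclidean_space \<Rightarrow> 'a \<Rightarrow> 'a) \<Rightarrow> 'a" where
  "contraction G = (\<Sum>b\<in>Basis. G b b)"

lemma linear_sum_Basis: "linear g \<Longrightarrow> (\<Sum>b\<in>Basis. (u \<bullet> b) *\<^sub>R g b) = g (u::'a::euclidean_space)"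
proof -
  assume g: "linear g"
  have "g u = g (\<Sum>b\<in>Basis. (u \<bullet> b) *\<^sub>R b)" by (simp add: euclidean_representation)
  also have "\<dots> = (\<Sum>b\<in>Basis. (u \<bullet> b) *\<^sub>R g b)" by (simp add: linear_sum[OF g] linear_scale[OF g])
  finally show ?thesis by simp
qed

lemma map_trace_add [simp]: "map_trace (\<lambda>b. g b + h b) = map_trace g + map_trace h"
  by (simp add: map_trace_def inner_add_left sum.distrib)

lemma map_trace_diff [simp]: "map_trace (\<lambda>b. g b - h b) = map_trace g - map_trace h"
  by (simp add: map_trace_def inner_diff_left sum_subtractf)

lemma map_trace_scaleR [simp]: "map_trace (\<lambda>b. c *\<^sub>R g b) = c * map_trace g"
  by (simp add: map_trace_def sum_distrib_left)

lemma map_trace_id [simp]: "map_trace (\<lambda>b::'a::euclidean_space. b) = real DIM('a)"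
  by (simp add: map_trace_def)

lemma map_trace_rank_one [simp]:
  fixes u z :: "'a::euclidean_space"
  shows "map_trace (\<lambda>b. (b \<bullet> u) *\<^sub>R z) = u \<bullet> z" "map_trace (\<lambda>b. (u \<bullet> b) *\<^sub>R z) = u \<bullet> z"
  by (simp_all add: map_trace_def euclidean_inner[of u z] inner_commute mult.commute)

lemma map_trace_rank_one_linear [simp]:
  fixes u z :: "'a::euclidean_space"
  assumes "linear g"
  shows "map_trace (\<lambda>b. (z \<bullet> g b) *\<^sub>R u) = z \<bullet> g u" "map_trace (\<lambda>b. (g b \<bullet> z) *\<^sub>R u) = g u \<bullet> z"
proof -
  have "map_trace (\<lambda>b. (z \<bullet> g b) *\<^sub>R u) = z \<bullet> (\<Sum>b\<in>Basis. (u \<bullet> b) *\<^sub>R g b)"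
    by (simp add: map_trace_def inner_sum_right mult.commute)
  then show "map_trace (\<lambda>b. (z \<bullet> g b) *\<^sub>R u) = z \<bullet> g u"
    by (simp add: linear_sum_Basis[OF assms])
  then show "map_trace (\<lambda>b. (g b \<bullet> z) *\<^sub>R u) = g u \<bullet> z"
    by (simp add: inner_commute)
qed

lemma contraction_add [simp]: "contraction (\<lambda>x y. G x y + H x y) = contraction G + contraction H"
  by (simp add: contraction_def sum.distrib)

lemma contraction_diff [simp]: "contraction (\<lambda>x y. G x y - H x y) = contraction G - contraction H"
  by (simp add: contraction_def sum_subtractf)

lemma contraction_scaleR [simp]: "contraction (\<lambda>x y. c *\<^sub>R G x y) = c *\<^sub>R contraction G"
  by (simp add: contraction_def scaleR_sum_right)

lemma contraction_inner [simp]: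
  "contraction (\<lambda>x y::'a::euclidean_space. (x \<bullet> y) *\<^sub>R z) = real DIM('a) *\<^sub>R z"
  by (simp add: contraction_def sum_constant_scaleR)

lemma contraction_inner_apply [simp]:
  fixes u :: "'a::euclidean_space"
  assumes "linear H"
  shows "contraction (\<lambda>x y. (x \<bullet> u) *\<^sub>R H y) = H u" "contraction (\<lambda>x y. (u \<bullet> x) *\<^sub>R H y) = H u"
    "contraction (\<lambda>x y. (y \<bullet> u) *\<^sub>R H x) = H u" "contraction (\<lambda>x y. (u \<bullet> y) *\<^sub>R H x) = H u"
  by (simp_all add: contraction_def linear_sum_Basis[OF assms] inner_commute[of _ u])

lemma contraction_inner_const [simp]:
  fixes z :: "'a::euclidean_space"
  shows "contraction (\<lambda>x y. (u \<bullet> G x y) *\<^sub>R z) = (u \<bullet> contraction G) *\<^sub>R z"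
    "contraction (\<lambda>x y. (G x y \<bullet> u) *\<^sub>R z) = (contraction G \<bullet> u) *\<^sub>R z"
  by (simp_all add: contraction_def inner_sum_left inner_sum_right scaleR_sum_left)

lemma contraction_map_trace [simp]:
  fixes z :: "'a::euclidean_space"
  shows "contraction (\<lambda>x y. (y \<bullet> H x) *\<^sub>R z) = map_trace H *\<^sub>R z"
    "contraction (\<lambda>x y. (x \<bullet> H y) *\<^sub>R z) = map_trace H *\<^sub>R z"
    "contraction (\<lambda>x y. (H x \<bullet> y) *\<^sub>R z) = map_trace H *\<^sub>R z"
    "contraction (\<lambda>x y. (H y \<bullet> x) *\<^sub>R z) = map_trace H *\<^sub>R z"
  by (simp_all add: contraction_def map_trace_def scaleR_sum_left inner_commute)

lemma contraction_adjoint [simp]: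
  fixes u :: "'a::euclidean_space"
  assumes "linear H"
  shows "contraction (\<lambda>x y. (H y \<bullet> u) *\<^sub>R x) = adjoint H u"
    "contraction (\<lambda>x y. (u \<bullet> H y) *\<^sub>R x) = adjoint H u"
    "contraction (\<lambda>x y. (H x \<bullet> u) *\<^sub>R y) = adjoint H u"
    "contraction (\<lambda>x y. (u \<bullet> H x) *\<^sub>R y) = adjoint H u"
proof -
  have *: "(\<Sum>b\<in>Basis. (H b \<bullet> u) *\<^sub>R b) = adjoint H u"
  proof (rule vector_eq_by_inner)
    fix k
    have "(\<Sum>b\<in>Basis. (H b \<bullet> u) *\<^sub>R b) \<bullet> k = (\<Sum>b\<in>Basis. (k \<bullet> b) * (H b \<bullet> u))"
      by (simp add: inner_sum_left) (simp add: inner_commute mult.commute)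
    also have "\<dots> = (\<Sum>b\<in>Basis. (k \<bullet> b) *\<^sub>R H b) \<bullet> u"
      by (simp add: inner_sum_left)
    also have "\<dots> = H k \<bullet> u"
      using linear_sum_Basis[OF assms, of k] by simp
    also have "\<dots> = adjoint H u \<bullet> k"
      by (metis adjoint_clauses(2)[OF assms] inner_commute)
    finally show "(\<Sum>b\<in>Basis. (H b \<bullet> u) *\<^sub>R b) \<bullet> k = adjoint H u \<bullet> k" .
  qed
  then show "contraction (\<lambda>x y. (H y \<bullet> u) *\<^sub>R x) = adjoint H u"
    "contraction (\<lambda>x y. (u \<bullet> H y) *\<^sub>R x) = adjoint H u"
    "contraction (\<lambda>x y. (H x \<bullet> u) *\<^sub>R y) = adjoint H u"
    "contraction (\<lambda>x y. (u \<bullet> H x) *\<^sub>R y) = adjoint H u"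
    by (simp_all add: contraction_def inner_commute[of u])
qed

lemma map_trace_phi_map:
  fixes A C :: "'a::euclidean_space \<Rightarrow> 'a"
  assumes A: "linear A" and C: "linear C"
  shows "map_trace (phi_map A C v x) = real DIM('a) * (A x \<bullet> v - C v \<bullet> x)"
  unfolding phi_map_def lie_act_def Q_euclid_def
  by (simp add: linear_add[OF A] linear_diff[OF A] linear_scale[OF A] A)
     (simp add: inner_commute algebra_simps)

lemma contraction_phi_map:
  fixes A C :: "'a::euclidean_space \<Rightarrow> 'a"
  assumes A: "linear A" and C: "linear C"
  shows "contraction (phi_map A C v)
    = real DIM('a) *\<^sub>R (A v + C v) + 2 *\<^sub>R (adjoint A v - map_trace A *\<^sub>R v - C v)"
  unfolding phi_map_def lie_act_def Q_euclid_def
  by (simp add: linear_add[OF A] linear_diff[OF A] linear_scale[OF A] A bounded_linear.linear[OF bounded_linear_ident])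
     (simp add: inner_commute algebra_simps, simp only: scaleR_2 mult_2_right scaleR_left_distrib add_ac)

locale bracket_symmetric =
  fixes Y :: "'a::euclidean_space \<Rightarrow> 'a \<Rightarrow> 'a \<Rightarrow> 'a"
  assumes linear_param [simp]: "linear (\<lambda>v. Y v x y)"
    and linear_left [simp]: "linear (\<lambda>x. Y v x y)"
    and symmetric: "Y v x y = Y v y x"
    and bracket_swap: "bracket (Y v) (Q_euclid w) x y z = bracket (Y w) (Q_euclid v) x y z"
begin

lemma linear_right [simp]: "linear (Y v x)"
proof -
  have "Y v x = (\<lambda>y. Y v y x)" by (rule ext, rule symmetric)
  then show ?thesis by simp
qed

lemmas linear_simps = linear_add[OF linear_param] linear_diff[OF linear_param]
  linear_scale[OF linear_param] linear_add[OF linear_left] linear_diff[OF linear_left]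
  linear_scale[OF linear_left] linear_add[OF linear_right] linear_diff[OF linear_right]
  linear_scale[OF linear_right]

end

lemma bracket_symmetric_diff:
  assumes "bracket_symmetric Y" and "bracket_symmetric Z"
  shows "bracket_symmetric (\<lambda>v x y. Y v x y - Z v x y)"
proof -
  interpret Y: bracket_symmetric Y by fact
  interpret Z: bracket_symmetric Z by fact
  show ?thesis
  proof (rule bracket_symmetric.intro)
    show "linear (\<lambda>v. Y v x y - Z v x y)" "linear (\<lambda>x. Y v x y - Z v x y)" for v x y
      by (simp_all add: linear_compose_sub)
    show "Y v x y - Z v x y = Y v y x - Z v y x" for v x y
      by (simp add: Y.symmetric[of v x y] Z.symmetric[of v x y])
    show "bracket (\<lambda>x y. Y v x y - Z v x y) (Q_euclid w) x y z
      = bracket (\<lambda>x y. Y w x y - Z w x y) (Q_euclid v) x y z" for v w x y z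
      by (simp add: bracket_diff_left Y.bracket_swap[of v w] Z.bracket_swap[of v w])
  qed
qed

lemma bracket_symmetric_phi_map:
  assumes A: "linear A" and C: "linear C"
  shows "bracket_symmetric (phi_map A C)"
proof (rule bracket_symmetric.intro)
  note LA = linear_add[OF A] linear_diff[OF A] linear_scale[OF A]
  note LC = linear_add[OF C] linear_diff[OF C] linear_scale[OF C]
  show "linear (\<lambda>v. phi_map A C v x y)" for x y
    by (rule linearI) (simp_all add: phi_map_def lie_act_def Q_euclid_def LA LC inner_simps algebra_simps)
  show "linear (\<lambda>x. phi_map A C v x y)" for v y
    by (rule linearI) (simp_all add: phi_map_def lie_act_def Q_euclid_def LA LC inner_simps algebra_simps)
  show "phi_map A C v x y = phi_map A C v y x" for v x y
    by (simp add: phi_map_def lie_act_def Q_euclid_def inner_commute algebra_simps)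
  show "bracket (phi_map A C v) (Q_euclid w) x y z = bracket (phi_map A C w) (Q_euclid v) x y z" for v w x y z
    by (rule bracket_phi_map_swap[OF A])
qed

locale traceless_bracket_symmetric = bracket_symmetric +
  assumes map_trace_right_zero: "map_trace (Y v x) = 0"
begin

lemma map_trace_zero [simp]: "map_trace (Y v x) = 0" "map_trace (\<lambda>b. Y v b x) = 0"
  using map_trace_right_zero by (auto simp: symmetric[of v _ x])

lemma inner_swap_param: "Y l a k \<bullet> m = Y m a k \<bullet> l"
proof -
  have contract: "map_trace (\<lambda>b. bracket (Y v) (Q_euclid w) a b k) = real DIM('a) * (Y v a k \<bullet> w)" for v w
    unfolding bracket_def Q_euclid_def
    by (simp add: linear_simps) (simp add: inner_commute symmetric algebra_simps)
  have "map_trace (\<lambda>b. bracket (Y l) (Q_euclid m) a b k) = map_trace (\<lambda>b. bracket (Y m) (Q_euclid l) a b k)"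
    using bracket_swap by simp
  then show ?thesis by (simp add: contract)
qed

lemma contraction_inner_swap: "contraction (Y v) \<bullet> x = contraction (Y x) \<bullet> v"
  by (simp add: contraction_def inner_sum_left inner_swap_param[of v _ _ x])

context
  fixes c :: real
  assumes contraction_eq: "\<And>v. contraction (Y v) = c *\<^sub>R v"
begin

lemma swap_param: "Y l a m = Y m a l"
proof (rule vector_eq_by_inner)
  fix k
  have contract: "contraction (\<lambda>x y. bracket (Y v) (Q_euclid w) a x y) \<bullet> k =
     real DIM('a) * (Y v a w \<bullet> k) + 2 * (Y v k a \<bullet> w) - (a \<bullet> w) * (contraction (Y v) \<bullet> k)
     - (a \<bullet> contraction (Y v)) * (w \<bullet> k) + (contraction (Y v) \<bullet> w) * (a \<bullet> k)" for v w
  proof -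
    have "contraction (\<lambda>x y. Y v y x) = contraction (Y v)"
      by (simp add: contraction_def symmetric)
    then show ?thesis
      unfolding bracket_def Q_euclid_def
      by (simp add: linear_simps) (simp add: inner_simps inner_commute symmetric algebra_simps adjoint_clauses)
  qed
  have "contraction (\<lambda>x y. bracket (Y l) (Q_euclid m) a x y) \<bullet> k
      = contraction (\<lambda>x y. bracket (Y m) (Q_euclid l) a x y) \<bullet> k"
    using bracket_swap by simp
  then have "real DIM('a) * (Y l a m \<bullet> k) = real DIM('a) * (Y m a l \<bullet> k)"
    unfolding contract contraction_eq using inner_swap_param[of l k a m]
    by (simp add: inner_commute algebra_simps)
  then show "Y l a m \<bullet> k = Y m a l \<bullet> k" by simp
qed

lemma map_trace_param_zero [simp]: "map_trace (\<lambda>b. Y b x y) = 0"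
proof -
  have "map_trace (\<lambda>b. Y b x y) = map_trace (Y y x)"
    unfolding map_trace_def by (rule sum.cong) (simp, metis swap_param)
  then show ?thesis by simp
qed

lemma swap_param_left: "Y l a m = Y a l m"
  by (metis symmetric swap_param)

lemma inner_swap_first: "k \<bullet> Y l a m = l \<bullet> Y k a m"
  by (metis inner_commute inner_swap_param)

lemma inner_Y_commute: "Y l a m \<bullet> k = k \<bullet> Y l a m"
  by (rule inner_commute)

lemma eq_zero: "Y l a m = 0"
proof (rule vector_eq_by_inner)
  fix k
  have "map_trace (\<lambda>b. bracket (Y b) (Q_euclid m) a k l) = map_trace (\<lambda>b. bracket (Y m) (Q_euclid b) a k l)"
    using bracket_swap by simp
  txt \<open>inner_Y_commute fixes the orientation of the inner products; the other three rules are
    permutative and sort the four arguments of k \<bullet> Y l a m into a normal form.\<close>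
  then have "0 = - 3 * real DIM('a) * (Y l a m \<bullet> k)"
    unfolding bracket_def Q_euclid_def
    by (simp add: linear_simps)
      (simp add: inner_Y_commute inner_swap_first swap_param_left symmetric algebra_simps)
  then show "Y l a m \<bullet> k = 0 \<bullet> k" by simp
qed

end

lemma eq_zero_if_contraction_symmetric:
  assumes "\<And>v x. contraction (Y v) \<bullet> x + contraction (Y x) \<bullet> v = 2 * c * (v \<bullet> x)"
  shows "Y v x y = 0"
proof -
  have "contraction (Y u) = c *\<^sub>R u" for u
    by (rule vector_eq_by_inner) (use assms[of u] contraction_inner_swap[of u] in simp)
  then show ?thesis by (rule eq_zero)
qed

end

context bracket_symmetric
begin

lemma linear_map_trace_param: "linear (\<lambda>v. map_trace (Y v x))"
  by (rule linearI) (simp_all add: map_trace_def linear_simps inner_add_left sum.distrib sum_distrib_left)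

lemma linear_contraction: "linear (\<lambda>v. contraction (Y v))"
  by (rule linearI) (simp_all add: contraction_def linear_simps sum.distrib scaleR_sum_right)

definition trace_vector :: "'a \<Rightarrow> 'a" where
  "trace_vector v = (\<Sum>a\<in>Basis. map_trace (Y v a) *\<^sub>R a)"

lemma inner_trace_vector: "trace_vector v \<bullet> x = map_trace (Y v x)"
proof -
  have "linear (\<lambda>x. map_trace (Y v x))"
    by (rule linearI) (simp_all add: map_trace_def linear_simps inner_add_left sum.distrib sum_distrib_left)
  then have "(\<Sum>a\<in>Basis. (x \<bullet> a) *\<^sub>R map_trace (Y v a)) = map_trace (Y v x)"
    by (rule linear_sum_Basis)
  moreover have "trace_vector v \<bullet> x = (\<Sum>a\<in>Basis. (x \<bullet> a) *\<^sub>R map_trace (Y v a))"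
    unfolding trace_vector_def inner_sum_left by (rule sum.cong) (simp_all add: inner_commute)
  ultimately show ?thesis by simp
qed

lemma linear_trace_vector: "linear trace_vector"
  by (rule linearI; rule vector_eq_by_inner)
    (simp_all add: inner_trace_vector inner_add_left linear_add[OF linear_map_trace_param]
      linear_scale[OF linear_map_trace_param])

lemma normalizing_phi_map:
  obtains A C c where "linear A" "linear C"
    and "traceless_bracket_symmetric (\<lambda>v x y. Y v x y - phi_map A C v x y)"
    and "\<And>v x. (contraction (Y v) - contraction (phi_map A C v)) \<bullet> x
        + (contraction (Y x) - contraction (phi_map A C x)) \<bullet> v = 2 * c * (v \<bullet> x)"
proof -
  define n where "n = real DIM('a)"
  have "n > 0" by (simp add: n_def)
  let ?T = trace_vector
  txt \<open>The partial trace of Y - phi_map A C is \<langle>T v - n (A^T v - C v), x\<rangle>, which vanishes for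
    C = A^T - T/n. For symmetric A its contraction is then P - 2n A + 2 tr A, whose symmetric
    part is a multiple of the identity once A is the symmetric part of P/(2n).\<close>
  define P where "P v = contraction (Y v) + ((n - 2) / n) *\<^sub>R ?T v" for v
  have "linear P"
    unfolding P_def using linear_contraction linear_trace_vector
    by (intro linear_compose_add linear_compose_scale_right) simp_all
  define A where "A v = (1 / (4 * n)) *\<^sub>R (P v + adjoint P v)" for v
  have "linear A"
    unfolding A_def using \<open>linear P\<close> adjoint_linear[OF \<open>linear P\<close>]
    by (intro linear_compose_add linear_compose_scale_right) simp_all
  have A_inner: "A v \<bullet> x = (P v \<bullet> x + P x \<bullet> v) / (4 * n)" for v x
    by (simp add: A_def inner_add_left adjoint_clauses(2)[OF \<open>linear P\<close>] inner_commute[of v "P x"])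
  have A_sym: "A v \<bullet> x = A x \<bullet> v" for v x
    by (simp add: A_inner add.commute)
  then have "adjoint A = A"
    by (metis adjoint_unique inner_commute)
  define C where "C v = A v - (1 / n) *\<^sub>R ?T v" for v
  have "linear C"
    unfolding C_def using \<open>linear A\<close> linear_trace_vector
    by (intro linear_compose_sub linear_compose_scale_right) simp_all
  interpret D: bracket_symmetric "\<lambda>v x y. Y v x y - phi_map A C v x y"
    by (rule bracket_symmetric_diff)
      (simp_all add: bracket_symmetric_axioms bracket_symmetric_phi_map \<open>linear A\<close> \<open>linear C\<close>)
  have traceless: "traceless_bracket_symmetric (\<lambda>v x y. Y v x y - phi_map A C v x y)"
  proof unfold_locales
    fix v x
    have "C v \<bullet> x = A x \<bullet> v - ?T v \<bullet> x / n"
      by (simp add: C_def inner_diff_left A_sym)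
    then show "map_trace (\<lambda>y. Y v x y - phi_map A C v x y) = 0"
      using \<open>n > 0\<close> by (simp add: map_trace_phi_map[OF \<open>linear A\<close> \<open>linear C\<close>] inner_trace_vector n_def)
  qed
  have contraction_D: "(contraction (Y v) - contraction (phi_map A C v)) \<bullet> x
      = P v \<bullet> x - 2 * n * (A v \<bullet> x) + 2 * map_trace A * (v \<bullet> x)" for v x
    using \<open>n > 0\<close>
    by (simp add: contraction_phi_map[OF \<open>linear A\<close> \<open>linear C\<close>] \<open>adjoint A = A\<close> C_def P_def
        n_def[symmetric] inner_simps inner_commute field_simps)
  show ?thesis
    by (rule that[OF \<open>linear A\<close> \<open>linear C\<close> traceless, where c = "2 * map_trace A"])
      (use \<open>n > 0\<close> in \<open>simp add: contraction_D A_inner field_simps, simp add: inner_commute\<close>)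
qed

lemma eq_phi_map:
  obtains A C where "linear A" "linear C" "Y = phi_map A C"
proof -
  obtain A C c where "linear A" "linear C"
    and "traceless_bracket_symmetric (\<lambda>v x y. Y v x y - phi_map A C v x y)"
    and contraction_D: "\<And>v x. (contraction (Y v) - contraction (phi_map A C v)) \<bullet> x
        + (contraction (Y x) - contraction (phi_map A C x)) \<bullet> v = 2 * c * (v \<bullet> x)"
    using normalizing_phi_map by blast
  then interpret D: traceless_bracket_symmetric "\<lambda>v x y. Y v x y - phi_map A C v x y"
    by simp
  have "Y v x y - phi_map A C v x y = 0" for v x y
    by (rule D.eq_zero_if_contraction_symmetric[where c = c]) (simp add: contraction_D)
  then show ?thesis
    using that \<open>linear A\<close> \<open>linear C\<close> by fastforce
qed
end

lemma bracket_symmetric_of_span: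
  assumes param: "\<And>x y. linear (\<lambda>v. Y v x y)" and left: "\<And>v y. linear (\<lambda>x. Y v x y)"
    and sym: "\<And>v x y. Y v x y = Y v y x"
    and span: "span S = UNIV"
    and swap: "\<And>v w. v \<in> S \<Longrightarrow> w \<in> S \<Longrightarrow> bracket (Y v) (Q_euclid w) = bracket (Y w) (Q_euclid v)"
  shows "bracket_symmetric Y"
proof (rule bracket_symmetric.intro[OF param left sym])
  fix v w \<xi> \<eta> \<theta>
  have "bilinear (Y u)" for u
    unfolding bilinear_def using left sym by (metis ext)
  then have bil: "bilinear (\<lambda>v w. bracket (Y v) (Q_euclid w) \<xi> \<eta> \<theta>)"
    by (rule bilinear_bracket_Q[OF param])
  then have "bilinear (\<lambda>w v. bracket (Y v) (Q_euclid w) \<xi> \<eta> \<theta>)"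
    by (simp add: bilinear_def)
  with bil show "bracket (Y v) (Q_euclid w) \<xi> \<eta> \<theta> = bracket (Y w) (Q_euclid v) \<xi> \<eta> \<theta>"
    by (rule bilinear_eq[where S = UNIV and B = S and T = UNIV and C = S]) (simp_all add: span swap)
qed

lemma Qv_eq_Q_euclid: "Qv = Q_euclid"
  by (simp add: fun_eq_iff Qv_def Q_euclid_def)

lemma brk_eq_bracket: "brk = bracket"
  by (simp add: fun_eq_iff brk_def bracket_def)

lemma LPhi_eq: "LPhi B A' B' i
    = (\<lambda>\<xi> \<eta>. lie_act ((*v) A') (Q_euclid (column i B)) \<xi> \<eta> + Q_euclid (column i B') \<xi> \<eta>)"
  by (simp add: fun_eq_iff LPhi_def lie_act_def Qv_eq_Q_euclid)

lemma LPsi_eq: "LPsi B q i j = (\<lambda>\<xi> \<eta> \<theta>.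
    bracket (q i) (Q_euclid (column j B)) \<xi> \<eta> \<theta> - bracket (q j) (Q_euclid (column i B)) \<xi> \<eta> \<theta>)"
  by (simp add: LPsi_def Qv_eq_Q_euclid brk_eq_bracket)

lemma LPhi_in_S2: "LPhi B A' B' i \<in> S2"
proof -
  have f: "linear ((*v) A')" by simp
  note L = linear_add[OF f] linear_diff[OF f] linear_scale[OF f]
  show ?thesis
    unfolding S2_def LPhi_eq bilinear_def
    by (auto intro!: linearI simp: lie_act_def Q_euclid_def L inner_simps inner_commute algebra_simps)
qed

lemma imLPhi_subset_kerLPsi: "imLPhi B \<subseteq> kerLPsi B"
proof
  fix q assume "q \<in> imLPhi B"
  then obtain A' B' where q: "q = LPhi B A' B'" by (auto simp: imLPhi_def)
  have "LPsi B q i j = (\<lambda>\<xi> \<eta> \<theta>. 0)" for i j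
    unfolding q LPsi_eq LPhi_eq
    by (simp add: fun_eq_iff bracket_add_left bracket_Q_Q bracket_lie_act_Q_swap[of "(*v) A'"])
  then show "q \<in> kerLPsi B"
    by (simp add: kerLPsi_def q LPhi_in_S2)
qed

lemma kerLPsi_extension:
  fixes B :: "real^'n::{finite,linorder}^'n::{finite,linorder}"
  assumes "invertible B" and "q \<in> kerLPsi B"
  obtains Y where "bracket_symmetric Y" and "\<And>i. Y (column i B) = q i"
proof -
  obtain B' where BB': "B ** B' = mat 1" and B'B: "B' ** B = mat 1"
    using assms(1) by (auto simp: invertible_def)
  have q_bilinear: "bilinear (q i)" and q_sym: "q i x y = q i y x" for i x y
    using assms(2) by (auto simp: kerLPsi_def S2_def)
  define Y where "Y v = (\<lambda>x y. \<Sum>j\<in>UNIV. (B' *v v) $ j *\<^sub>R q j x y)" for v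
  have Y_column: "Y (column i B) = q i" for i
  proof -
    have "B' *v column i B = axis i 1"
      by (simp add: matrix_vector_mult_basis[symmetric] matrix_vector_mul_assoc B'B)
    then show ?thesis
      by (simp add: Y_def fun_eq_iff axis_def if_distrib[of "\<lambda>c. c *\<^sub>R _"] cong: if_cong)
  qed
  have "bracket_symmetric Y"
  proof (rule bracket_symmetric_of_span[where S = "columns B"])
    show "linear (\<lambda>v. Y v x y)" for x y
      by (rule linearI) (simp_all add: Y_def matrix_vector_right_distrib scaleR_add_left sum.distrib
          scaleR_sum_right linear_scale[OF matrix_vector_mul_linear])
    show "linear (\<lambda>x. Y v x y)" for v y
      by (rule linearI) (simp_all add: Y_def bilinear_ladd[OF q_bilinear] bilinear_lmul[OF q_bilinear]
          scaleR_add_right sum.distrib scaleR_sum_right mult.commute)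
    show "Y v x y = Y v y x" for v x y
      by (simp add: Y_def q_sym[of _ x y])
    show "span (columns B) = UNIV"
      using matrix_right_invertible_span_columns[of B] BB' by (auto simp: span_vec_eq)
    show "bracket (Y v) (Q_euclid w) = bracket (Y w) (Q_euclid v)"
      if v: "v \<in> columns B" and w: "w \<in> columns B" for v w
    proof -
      obtain i j where v_eq: "v = column i B" and w_eq: "w = column j B"
        using v w unfolding columns_def by blast
      have "bracket (q i) (Q_euclid (column j B)) = bracket (q j) (Q_euclid (column i B))"
        if "i < j" for i j
        using assms(2) that by (fastforce simp: kerLPsi_def LPsi_eq fun_eq_iff)
      then show ?thesis
        unfolding v_eq w_eq Y_column by (cases i j rule: linorder_cases) auto
    qed
  qed
  then show ?thesis
    by (rule that[OF _ Y_column])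
qed

lemma LPhi_matrix_phi_map:
  assumes "linear A" and "linear C"
  shows "LPhi B (matrix A) (matrix C ** B) i = phi_map A C (column i B)"
proof -
  have "column i (matrix C ** B) = matrix C *v column i B"
    by (simp add: column_def matrix_matrix_mult_def matrix_vector_mult_def vec_eq_iff)
  also have "\<dots> = C (column i B)"
    using assms(2) by simp
  finally have "column i (matrix C ** B) = C (column i B)" .
  then show ?thesis
    using assms by (simp add: LPhi_eq phi_map_def fun_eq_iff)
qed

lemma kerLPsi_subset_imLPhi:
  assumes "invertible B"
  shows "kerLPsi B \<subseteq> imLPhi B"
proof
  fix q assume "q \<in> kerLPsi B"
  obtain Y where "bracket_symmetric Y" and Y_column: "\<And>i. Y (column i B) = q i"
    using kerLPsi_extension[OF assms \<open>q \<in> kerLPsi B\<close>] by blast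
  then obtain A C where "linear A" "linear C" and "Y = phi_map A C"
    using bracket_symmetric.eq_phi_map by blast
  then have "q = LPhi B (matrix A) (matrix C ** B)"
    by (simp add: fun_eq_iff LPhi_matrix_phi_map flip: Y_column)
  then show "q \<in> imLPhi B"
    by (auto simp: imLPhi_def)
qed

theorem proposition2p8:
  fixes B :: "(real^('n::{finite,linorder}))^('n::{finite,linorder})"
  assumes "invertible B"
  shows "kerLPsi B = imLPhi B"
  using imLPhi_subset_kerLPsi kerLPsi_subset_imLPhi[OF assms] by blast

end
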